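(* Assume that $\rho_{\mathbf 0}>\rho_{\mathbf 1}$ and that $h:[0,T]\times\mathcal S\to(0,\infty)$ solves the linear ODE system $$\frac{\partial h}{\partial t}(t,i)-\rho_ih(t,i)+\sum_{j\in\mathcal S}\lambda_{ij}h(t,j)+1=0,\qquad h(T,i)=1,\quad i\in\mathcal S.$$ Let $F_2(t,x,i)=h^{-1}(t,i)\,x$, where $h^{-1}(t,i)=1/h(t,i)$. Then $F_2(t,x,\mathbf 0)>F_2(t,x,\mathbf 1)$ for any $x>0$ and $t\in[0,T)$. In other words, the subgame perfect consumption rate is higher in the states in which the discount rate is higher.
   Context: $T\in(0,\infty)$ is fixed, $\mathcal S=\{\mathbf 0,\mathbf 1\}$ is the state space of a homogeneous continuous-time Markov chain with generator $\Lambda=[\lambda_{ij}]_{i,j\in\mathcal S}$, where $\lambda_{ij}\ge0$ for $i\neq j$ and $\sum_{j\in\mathcal S}\lambda_{ij}=0$ for each $i$. $\rho_{\mathbf 0},\rho_{\mathbf 1}$ are positive constants (the discount rates in the two states). In the regime-switching investment-consumption model with logarithmic utility, $F_2(t,x,i)$ is the subgame perfect consumption at time $t$ when wealth is $x$ and the Markov chain is in state $i$. *)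

theory Defs
  imports Complex_Main
begin

datatype state = S0 | S1

instantiation state :: finite
begin
instance
proof
  have "(UNIV :: state set) = {S0, S1}"
    using state.exhaust by blast
  then show "finite (UNIV :: state set)"
    by (metis finite.emptyI finite.insertI)
qed
end

definition is_generator :: "('s::finite \<Rightarrow> 's \<Rightarrow> real) \<Rightarrow> bool" where
  "is_generator \<Lambda> \<longleftrightarrow>
     (\<forall>i j. i \<noteq> j \<longrightarrow> \<Lambda> i j \<ge> 0) \<and> (\<forall>i. (\<Sum>j\<in>UNIV. \<Lambda> i j) = 0)"

text \<open>The time derivative is one-sided at the endpoints of \<open>[0,T]\<close>; values of \<open>h\<close>
  outside \<open>[0,T]\<close> are unconstrained.\<close>

definition solves_h_system ::
  "real \<Rightarrow> ('s::finite \<Rightarrow> 's \<Rightarrow> real) \<Rightarrow> ('s \<Rightarrow> real) \<Rightarrow> (real \<Rightarrow> 's \<Rightarrow> real) \<Rightarrow> bool" where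
  "solves_h_system T \<Lambda> \<rho> h \<longleftrightarrow>
     (\<forall>i. \<forall>t\<in>{0..T}. \<exists>h'.
        ((\<lambda>s. h s i) has_real_derivative h') (at t within {0..T}) \<and>
        h' - \<rho> i * h t i + (\<Sum>j\<in>UNIV. \<Lambda> i j * h t j) + 1 = 0) \<and>
     (\<forall>i. h T i = 1)"

definition F2 :: "(real \<Rightarrow> 's \<Rightarrow> real) \<Rightarrow> real \<Rightarrow> real \<Rightarrow> 's \<Rightarrow> real" where
  "F2 h t x i = inverse (h t i) * x"

end

theory Submission
  imports Defs
begin

text \<open>Consumption is inversely proportional to \<open>h\<close>, so the claim is that the gap
  \<open>d(t) = h(t,0) - h(t,1)\<close> is negative before \<open>T\<close>. Each row of the generator sums to zero, so the
  chain couples the two states only through \<open>d\<close>. Subtracting the two equations and writing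
  \<open>\<rho>\<^sub>0 h(t,0) - \<rho>\<^sub>1 h(t,1) = (\<rho>\<^sub>0 - \<rho>\<^sub>1) h(t,0) + \<rho>\<^sub>1 d(t)\<close> therefore makes the system
  collapse to a scalar equation,

  \<open>d'(t) = (\<rho>\<^sub>0 - \<rho>\<^sub>1) h(t,0) + c d(t)\<close>, with \<open>c = \<rho>\<^sub>1 + \<lambda>\<^sub>0\<^sub>1 + \<lambda>\<^sub>1\<^sub>0\<close> and \<open>d(T) = 0\<close>.

  Its source term is positive, so \<open>d'(t) > c d(t)\<close>: multiplied by the integrating factor
  \<open>exp (-c t)\<close>, the gap is strictly increasing, and so it can reach zero at \<open>T\<close> only from below.
  This last argument is \<open>neg_before_zero_of_deriv_gt_linear\<close>.\<close>

text \<open>A strict Gronwall inequality run backwards from the end point: with \<open>f' > c f\<close> the function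
  \<open>exp (-c s) * f s\<close> is strictly increasing, and it has the sign of \<open>f\<close>.\<close>

lemma neg_before_zero_of_deriv_gt_linear:
  fixes f f' :: "real \<Rightarrow> real"
  assumes deriv: "\<And>s. s \<in> {a..b} \<Longrightarrow> (f has_real_derivative f' s) (at s within {a..b})"
    and gt: "\<And>s. s \<in> {a..b} \<Longrightarrow> f' s > c * f s"
    and final: "f b \<le> 0"
    and t: "t \<in> {a..<b}"
  shows "f t < 0"
proof -
  let ?g = "\<lambda>s. exp (- c * s) * f s"
  have g_deriv: "(?g has_real_derivative exp (- c * s) * (f' s - c * f s)) (at s within {a..b})"
    if "s \<in> {a..b}" for s
  proof -
    have "((\<lambda>s. exp (- c * s)) has_real_derivative exp (- c * s) * (- c)) (at s within {a..b})"
      by (auto intro!: derivative_eq_intros)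
    from DERIV_mult[OF this deriv[OF that]] show ?thesis
      by (simp add: algebra_simps)
  qed
  have "?g t < ?g b"
  proof (rule DERIV_pos_imp_increasing_open[where f = ?g])
    show "t < b" using t by simp
    show "\<exists>y. (?g has_real_derivative y) (at s) \<and> 0 < y" if "t < s" "s < b" for s
    proof -
      have s: "s \<in> {a..b}" and "at s within {a..b} = at s"
        using that t by (auto intro!: at_within_Icc_at)
      with g_deriv[OF s] have "(?g has_real_derivative exp (- c * s) * (f' s - c * f s)) (at s)"
        by simp
      then show ?thesis
        using gt[OF s] by (intro exI conjI) (assumption, simp)
    qed
    have "continuous_on {a..b} ?g"
      using g_deriv by (rule DERIV_continuous_on)
    then show "continuous_on {t..b} ?g"
      by (rule continuous_on_subset) (use t in auto)
  qed
  also have "?g b \<le> 0"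
    using final by (simp add: mult_nonneg_nonpos)
  finally show ?thesis
    by (simp add: mult_less_0_iff)
qed

lemma sum_over_state: "(\<Sum>j\<in>UNIV. f j) = f S0 + f S1"
proof -
  have "(UNIV :: state set) = {S0, S1}"
    using state.exhaust by blast
  then have "(\<Sum>j\<in>UNIV. f j) = sum f {S0, S1}" by (rule arg_cong)
  then show ?thesis by simp
qed

theorem lemma3p5:
  fixes T :: real
    and \<Lambda> :: "state \<Rightarrow> state \<Rightarrow> real"
    and \<rho> :: "state \<Rightarrow> real"
    and h :: "real \<Rightarrow> state \<Rightarrow> real"
  assumes "T > 0"
    and "is_generator \<Lambda>"
    and "\<And>i. \<rho> i > 0"
    and "\<rho> S0 > \<rho> S1"
    and "\<And>t i. t \<in> {0..T} \<Longrightarrow> h t i > 0"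
    and "solves_h_system T \<Lambda> \<rho> h"
  shows "\<forall>x>0. \<forall>t\<in>{0..<T}. F2 h t x S0 > F2 h t x S1"
proof (intro allI impI ballI)
  fix x t :: real
  assume x: "0 < x" and t: "t \<in> {0..<T}"
  have diag: "\<Lambda> S0 S0 = - \<Lambda> S0 S1" "\<Lambda> S1 S1 = - \<Lambda> S1 S0"
    using \<open>is_generator \<Lambda>\<close> by (simp_all add: is_generator_def sum_over_state add_eq_0_iff)
  have final: "h T i = 1" for i
    using \<open>solves_h_system T \<Lambda> \<rho> h\<close> by (simp add: solves_h_system_def)
  have h_deriv: "((\<lambda>s. h s i) has_real_derivative
      \<rho> i * h s i - (\<Lambda> i S0 * h s S0 + \<Lambda> i S1 * h s S1) - 1) (at s within {0..T})"
    if "s \<in> {0..T}" for s i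
  proof -
    have "\<exists>h'. ((\<lambda>s. h s i) has_real_derivative h') (at s within {0..T}) \<and>
        h' - \<rho> i * h s i + (\<Sum>j\<in>UNIV. \<Lambda> i j * h s j) + 1 = 0"
      using assms(6) that by (simp add: solves_h_system_def)
    then obtain h' where h': "((\<lambda>s. h s i) has_real_derivative h') (at s within {0..T})"
      and eq: "h' - \<rho> i * h s i + (\<Sum>j\<in>UNIV. \<Lambda> i j * h s j) + 1 = 0"
      by (elim exE conjE)
    have "h' = \<rho> i * h s i - (\<Lambda> i S0 * h s S0 + \<Lambda> i S1 * h s S1) - 1"
      using eq by (simp add: sum_over_state)
    with h' show ?thesis by simp
  qed
  let ?d = "\<lambda>s. h s S0 - h s S1"
  let ?c = "\<rho> S1 + \<Lambda> S0 S1 + \<Lambda> S1 S0"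
  let ?d' = "\<lambda>s. (\<rho> S0 - \<rho> S1) * h s S0 + ?c * ?d s"
  have "?d t < 0"
  proof (rule neg_before_zero_of_deriv_gt_linear[where f = ?d and f' = ?d' and c = ?c])
    show "(?d has_real_derivative ?d' s) (at s within {0..T})"
      if "s \<in> {0..T}" for s
      using DERIV_diff[OF h_deriv[OF that, of S0] h_deriv[OF that, of S1]]
      by (simp add: diag algebra_simps)
    show "?c * ?d s < ?d' s" if "s \<in> {0..T}" for s
      using assms(4) assms(5)[OF that] by simp
  qed (use final t in auto)
  moreover have "0 < h t S0"
    using assms(5) t by simp
  ultimately have "inverse (h t S1) < inverse (h t S0)"
    by (simp add: less_imp_inverse_less)
  with x show "F2 h t x S1 < F2 h t x S0"
    by (simp add: F2_def)
qed

end
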